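(* Let $G$ be a finite group with identity $e$ and $|G|=m$, and let $n=m+1$. Let $S,T\subseteq G\setminus\{e\}$ be disjoint and let $V=(G\setminus\{e\})\setminus(S\cup T)$, so that $G\setminus\{e\}=S\cup T\cup V$. Let $\omega=-\frac12+i\frac{\sqrt3}{2}$ and $\mu=|S|-|T|$. For $x\in G$ put $$\begin{aligned}F(x)={}&N_{(S,S)}^x+\omega^2N_{(T,T)}^x+\omega N_{(V,V)}^x+\omega\big(N_{(S,T)}^x+N_{(T,S)}^x\big)\\&+\omega^2\big(N_{(S,V)}^x+N_{(V,S)}^x\big)+N_{(T,V)}^x+N_{(V,T)}^x.\end{aligned}$$ Then there exists a $k$ such that $(S,T)$ is a quasi-signature pair of sets for an $(n,k)$-cube root equiangular frame if and only if the following hold: (1) $S=S^{-1}$ and $T^{-1}=V$; (2) (a) $F(g)=\mu-1$ for all $g\in S$; (b) $F(h)=\omega\mu-1$ for all $h\in T$; (c) $F(\tilde h)=\omega^2\mu-1$ for all $\tilde h\in V$. In this case $\mu$ is related to $k$ by $$\mu=(n-2k)\sqrt{\frac{n-1}{k(n-k)}},\qquad k=\frac n2-\frac{\mu n}{2\sqrt{4(n-1)+\mu^2}}.$$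
   Context: For subsets $A,B\subseteq G$ and $g\in G$, $N_{(A,B)}^g=\#\{(g_1,g_2)\in A\times B: g_1g_2=g\}$, and $A^{-1}=\{a^{-1}:a\in A\}$. An $(n,k)$-frame is a Parseval frame $\{f_1,\dots,f_n\}$ for $\mathbb C^k$, i.e. $\sum_{j}|\langle x,f_j\rangle|^2=\|x\|^2$ for all $x\in\mathbb C^k$. It is equiangular if all $f_i\neq 0$ and there is a constant $b$ with $|\langle f_i/\|f_i\|,f_j/\|f_j\|\rangle|=b$ for all $i\ne j$. For $1\le k<n$, put $c_{n,k}=\sqrt{\frac{k(n-k)}{n^2(n-1)}}$. A self-adjoint $n\times n$ matrix $Q$ with $Q_{ii}=0$ and $|Q_{ij}|=1$ for $i\neq j$ is the signature matrix of an $(n,k)$-equiangular frame if there is an equiangular $(n,k)$-frame whose Gram matrix $(\langle f_j,f_i\rangle)_{i,j}$ equals $\frac kn I_n+c_{n,k}Q$. Throughout $1\le k<n$. Let $\lambda$ be the left regular representation of $G$: $\lambda(g)e_h=e_{gh}$ on the vector space with basis $\{e_h\}_{h\in G}$, regarded as $m\times m$ permutation matrices. Let $Q=\sum_{g\in S}\lambda(g)+\omega\sum_{h\in T}\lambda(h)+\omega^2\sum_{\tilde h\in V}\lambda(\tilde h)$ and $\tilde Q=\begin{bmatrix}0&C^t\\ C&Q\end{bmatrix}$, where $C\in\mathbb C^m$ is the all-ones column vector. With $n=m+1$, $(S,T)$ is a quasi-signature pair of sets for an $(n,k)$-cube root equiangular frame if the $n\times n$ matrix $\tilde Q$ is the signature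 matrix of an $(n,k)$-equiangular frame. *)

theory Defs
  imports "HOL-Algebra.Coset" "Jordan_Normal_Form.Schur_Decomposition"
begin

text \<open>
  The inner product on complex vectors is the library's \<open>x \<bullet>c y\<close>, which is linear in the
  first and conjugate-linear in the second argument.  A family \<open>f\<^sub>1, \<dots>, f\<^sub>n\<close> is a function on
  naturals, of which only the values at \<open>j < n\<close> matter.
\<close>

definition cvec_norm :: "complex vec \<Rightarrow> real" where
  "cvec_norm x = sqrt (Re (x \<bullet>c x))"

definition parseval_frame :: "nat \<Rightarrow> nat \<Rightarrow> (nat \<Rightarrow> complex vec) \<Rightarrow> bool" where
  "parseval_frame n k f \<longleftrightarrow>
     (\<forall>j<n. f j \<in> carrier_vec k) \<and>
     (\<forall>x\<in>carrier_vec k. (\<Sum>j<n. (cmod (x \<bullet>c f j))\<^sup>2) = (cvec_norm x)\<^sup>2)"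

definition cvec_normalize :: "complex vec \<Rightarrow> complex vec" where
  "cvec_normalize x = complex_of_real (1 / cvec_norm x) \<cdot>\<^sub>v x"

definition equiangular_frame :: "nat \<Rightarrow> nat \<Rightarrow> (nat \<Rightarrow> complex vec) \<Rightarrow> bool" where
  "equiangular_frame n k f \<longleftrightarrow>
     parseval_frame n k f \<and>
     (\<forall>i<n. f i \<noteq> 0\<^sub>v k) \<and>
     (\<exists>b::real. \<forall>i<n. \<forall>j<n. i \<noteq> j \<longrightarrow>
        cmod (cvec_normalize (f i) \<bullet>c cvec_normalize (f j)) = b)"

definition gram_mat :: "nat \<Rightarrow> (nat \<Rightarrow> complex vec) \<Rightarrow> complex mat" where
  "gram_mat n f = mat n n (\<lambda>(i, j). f j \<bullet>c f i)"

definition frame_const :: "nat \<Rightarrow> nat \<Rightarrow> real" where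
  "frame_const n k = sqrt (real k * (real n - real k) / ((real n)\<^sup>2 * (real n - 1)))"

text \<open>The standing assumption \<open>1 \<le> k < n\<close> is part of the following notion.\<close>

definition signature_matrix :: "nat \<Rightarrow> nat \<Rightarrow> complex mat \<Rightarrow> bool" where
  "signature_matrix n k Q \<longleftrightarrow>
     1 \<le> k \<and> k < n \<and>
     Q \<in> carrier_mat n n \<and> mat_adjoint Q = Q \<and>
     (\<forall>i<n. Q $$ (i, i) = 0) \<and>
     (\<forall>i<n. \<forall>j<n. i \<noteq> j \<longrightarrow> cmod (Q $$ (i, j)) = 1) \<and>
     (\<exists>f. equiangular_frame n k f \<and>
        gram_mat n f =
          complex_of_real (real k / real n) \<cdot>\<^sub>m 1\<^sub>m n + complex_of_real (frame_const n k) \<cdot>\<^sub>m Q)"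

definition cube_omega :: complex where
  "cube_omega = - (1/2) + \<i> * complex_of_real (sqrt 3 / 2)"

text \<open>
  Matrices indexed by a finite group are made into matrices indexed by naturals through an
  enumeration \<open>elt\<close> of the group: a bijection from \<open>{0..<card (carrier G)}\<close> to \<open>carrier G\<close>.
  Since \<open>\<lambda>(g) e\<^sub>h = e\<^sub>g\<^sub>h\<close>, column \<open>h\<close> of \<open>\<lambda>(g)\<close> has its only nonzero entry in row \<open>gh\<close>.
\<close>

definition left_regular :: "('a, 'b) monoid_scheme \<Rightarrow> (nat \<Rightarrow> 'a) \<Rightarrow> 'a \<Rightarrow> complex mat" where
  "left_regular G elt g =
     mat (card (carrier G)) (card (carrier G))
       (\<lambda>(i, j). if elt i = g \<otimes>\<^bsub>G\<^esub> elt j then 1 else 0)"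

definition left_regular_sum ::
    "('a, 'b) monoid_scheme \<Rightarrow> (nat \<Rightarrow> 'a) \<Rightarrow> 'a set \<Rightarrow> complex mat" where
  "left_regular_sum G elt A =
     finsum (module_mat TYPE(complex) (card (carrier G)) (card (carrier G))) (left_regular G elt) A"

definition cube_root_matrix ::
    "('a, 'b) monoid_scheme \<Rightarrow> (nat \<Rightarrow> 'a) \<Rightarrow> 'a set \<Rightarrow> 'a set \<Rightarrow> 'a set \<Rightarrow> complex mat" where
  "cube_root_matrix G elt S T V =
     left_regular_sum G elt S + cube_omega \<cdot>\<^sub>m left_regular_sum G elt T
       + cube_omega\<^sup>2 \<cdot>\<^sub>m left_regular_sum G elt V"

definition bordered_mat :: "nat \<Rightarrow> complex mat \<Rightarrow> complex mat" where
  "bordered_mat m Q =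
     (let C = mat m 1 (\<lambda>_. 1) in four_block_mat (0\<^sub>m 1 1) (transpose_mat C) C Q)"

definition quasi_signature_pair ::
    "('a, 'b) monoid_scheme \<Rightarrow> (nat \<Rightarrow> 'a) \<Rightarrow> nat \<Rightarrow> nat \<Rightarrow> 'a set \<Rightarrow> 'a set \<Rightarrow> bool" where
  "quasi_signature_pair G elt n k S T \<longleftrightarrow>
     n = card (carrier G) + 1 \<and>
     signature_matrix n k
       (bordered_mat (card (carrier G))
         (cube_root_matrix G elt S T ((carrier G - {\<one>\<^bsub>G\<^esub>}) - (S \<union> T))))"

definition prod_count :: "('a, 'b) monoid_scheme \<Rightarrow> 'a set \<Rightarrow> 'a set \<Rightarrow> 'a \<Rightarrow> nat" where
  "prod_count G A B g = card {(g1, g2). g1 \<in> A \<and> g2 \<in> B \<and> g1 \<otimes>\<^bsub>G\<^esub> g2 = g}"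

definition cube_root_count ::
    "('a, 'b) monoid_scheme \<Rightarrow> 'a set \<Rightarrow> 'a set \<Rightarrow> 'a set \<Rightarrow> 'a \<Rightarrow> complex" where
  "cube_root_count G S T V x =
     of_nat (prod_count G S S x)
     + cube_omega\<^sup>2 * of_nat (prod_count G T T x)
     + cube_omega * of_nat (prod_count G V V x)
     + cube_omega * (of_nat (prod_count G S T x) + of_nat (prod_count G T S x))
     + cube_omega\<^sup>2 * (of_nat (prod_count G S V x) + of_nat (prod_count G V S x))
     + of_nat (prod_count G T V x) + of_nat (prod_count G V T x)"

end

theory Submission
  imports Defs
begin

text \<open>
  The Gram matrices of Parseval frames of \<open>n\<close> vectors for complex \<open>k\<close>-space are exactly the
  Hermitian idempotents of size \<open>n\<close> and trace \<open>k\<close>.  If \<open>k/n \<sqdot> I + c \<sqdot> Q\<close> is idempotent, with \<open>c > 0\<close>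
  the constant of the frame, then comparing coefficients turns idempotence into a quadratic equation
  \<open>Q\<^sup>2 = (n - 1) I + \<mu> Q\<close> with \<open>\<mu> = (n - 2k) sqrt ((n - 1) / (k (n - k)))\<close>
  (\<open>signature_matrix_square\<close>).  Conversely, let a Hermitian \<open>Q\<close> with zero diagonal and unimodular
  entries elsewhere satisfy this equation for some real \<open>\<mu>\<close>.  Then it has at most two eigenvalues,
  and the spectral projection onto the larger one has the form \<open>a I + c Q\<close>; it is the Gram
  matrix of a Parseval frame in dimension \<open>k = n a\<close>, the trace of the projection.  Its constant
  diagonal and its off-diagonal entries of constant modulus make the frame equiangular
  (\<open>signature_matrixI\<close>).

  It remains to read off \<open>Q\<^sup>2 = (n - 1) I + \<mu> Q\<close> for the bordered matrix of the group.  Its inner block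
  has entries \<open>q (g h\<^sup>-\<^sup>1)\<close>, where \<open>q\<close> is \<open>1\<close>, \<open>\<omega>\<close>, \<open>\<omega>\<^sup>2\<close> on \<open>S\<close>, \<open>T\<close>, \<open>V\<close> and \<open>0\<close> at the identity.  The
  matrix is Hermitian iff \<open>q (g\<^sup>-\<^sup>1)\<close> is the conjugate of \<open>q g\<close>, which is the
  condition on inverses of \<open>S\<close> and \<open>T\<close>.  The border of the equation says that \<open>\<mu>\<close> is the sum of \<open>q\<close> over the group, that is \<open>|S| - |T|\<close> because \<open>|T| = |V|\<close>
  and \<open>\<omega> + \<omega>\<^sup>2 = -1\<close>.  The inner block says \<open>1 + (q * q)(x) = \<mu> q x\<close> for \<open>x\<close> other than the identity,
  and \<open>F\<close> is the convolution square \<open>q * q\<close>, as one sees from \<open>\<omega>\<^sup>3 = 1\<close>; on \<open>S\<close>, \<open>T\<close>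
  and \<open>V\<close> these are the prescribed values of \<open>F\<close>.
\<close>

section \<open>Hermitian idempotents\<close>

text \<open>
  A spectral theorem for projections.  If some diagonal entry \<open>d = P c c\<close> is nonzero,
  then column \<open>c\<close> divided by \<open>sqrt d\<close> is a unit vector \<open>w\<close> in the range of \<open>P\<close>, and subtracting the
  rank-one projection onto \<open>w\<close> leaves a projection with strictly more zeros on the diagonal.  A
  projection with zero diagonal vanishes, since its diagonal entries are the squared lengths of its
  rows.
\<close>
lemma hermitian_idempotent_orthonormal_decomposition:
  fixes P :: "nat \<Rightarrow> nat \<Rightarrow> complex"
  assumes "\<forall>i<n. \<forall>j<n. P j i = cnj (P i j)"
    and "\<forall>i<n. \<forall>j<n. (\<Sum>l<n. P i l * P l j) = P i j"
  shows "\<exists>(k :: nat) v. (\<forall>i<n. \<forall>j<n. P i j = (\<Sum>a<k. v a i * cnj (v a j))) \<and>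
    (\<forall>a<k. \<forall>b<k. (\<Sum>i<n. v a i * cnj (v b i)) = (if a = b then 1 else 0 :: complex))"
  using assms
proof (induction "card {i. i < n \<and> P i i \<noteq> 0}" arbitrary: P rule: less_induct)
  case less
  have herm: "P j i = cnj (P i j)" if "i < n" "j < n" for i j
    using less.prems(1) that by blast
  have idem: "(\<Sum>l<n. P i l * P l j) = P i j" if "i < n" "j < n" for i j
    using less.prems(2) that by blast
  have diag: "P i i = of_real (\<Sum>l<n. (cmod (P i l))\<^sup>2)" if "i < n" for i
  proof -
    have "P i i = (\<Sum>l<n. P i l * P l i)" using idem that by simp
    also have "\<dots> = (\<Sum>l<n. of_real ((cmod (P i l))\<^sup>2))"
    proof (intro sum.cong refl)
      fix l assume "l \<in> {..<n}"
      then have "P l i = cnj (P i l)" using herm[OF that] by simp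
      then show "P i l * P l i = of_real ((cmod (P i l))\<^sup>2)"
        by (simp only: complex_norm_square)
    qed
    finally show ?thesis by simp
  qed
  have row_zero: "P i j = 0" if "i < n" "j < n" "P i i = 0" for i j
  proof -
    have "(\<Sum>l<n. (cmod (P i l))\<^sup>2) = 0"
      using diag[OF that(1)] that(3) by (metis of_real_eq_0_iff)
    then show ?thesis using that(2) by (subst (asm) sum_nonneg_eq_0_iff) auto
  qed
  show ?case
  proof (cases "\<forall>i<n. P i i = 0")
    case True
    then have "\<forall>i<n. \<forall>j<n. P i j = 0" using row_zero by blast
    then show ?thesis by (auto intro!: exI[of _ "0 :: nat"])
  next
    case False
    then obtain c where c: "c < n" "P c c \<noteq> 0" by auto
    define d where "d = (\<Sum>l<n. (cmod (P c l))\<^sup>2)"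
    have Pcc: "P c c = of_real d" using diag[OF c(1)] by (simp add: d_def)
    have "d \<ge> 0" unfolding d_def by (simp add: sum_nonneg)
    with Pcc c have d: "d > 0" by (metis less_eq_real_def of_real_0)
    define w where "w i = P i c / of_real (sqrt d)" for i
    have ww: "w i * cnj (w j) = P i c * P c j / of_real d" if "i < n" "j < n" for i j
      using d herm[OF that(2) c(1)] unfolding w_def
      by (simp add: field_simps flip: of_real_mult)
    have Pw: "(\<Sum>l<n. P i l * w l) = w i" if "i < n" for i
      using idem[OF that c(1)] by (simp add: w_def flip: sum_divide_distrib)
    have wP: "(\<Sum>l<n. cnj (w l) * P l j) = cnj (w j)" if "j < n" for j
    proof -
      have "(\<Sum>l<n. cnj (w l) * P l j) = cnj (\<Sum>l<n. P j l * w l)"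
        unfolding cnj_sum
      proof (intro sum.cong refl)
        fix l assume "l \<in> {..<n}"
        then have "P l j = cnj (P j l)" using herm[OF that] by simp
        then show "cnj (w l) * P l j = cnj (P j l * w l)" by (simp only: complex_cnj_mult mult.commute)
      qed
      then show ?thesis using Pw[OF that] by simp
    qed
    have w1: "(\<Sum>l<n. cnj (w l) * w l) = 1"
    proof -
      have "(\<Sum>l<n. cnj (w l) * w l) = (\<Sum>l<n. P c l * P l c) / of_real d"
        unfolding sum_divide_distrib using ww by (intro sum.cong refl) (simp add: mult.commute)
      then show ?thesis using idem[OF c(1) c(1)] Pcc d by simp
    qed
    define P' where "P' i j = P i j - w i * cnj (w j)" for i j
    have herm': "P' j i = cnj (P' i j)" if "i < n" "j < n" for i j
      using herm[OF that] by (simp add: P'_def mult.commute)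
    have wP': "(\<Sum>l<n. cnj (w l) * P' l j) = 0" if "j < n" for j
    proof -
      have "(\<Sum>l<n. cnj (w l) * P' l j)
          = (\<Sum>l<n. cnj (w l) * P l j) - (\<Sum>l<n. cnj (w l) * w l) * cnj (w j)"
        by (simp add: P'_def algebra_simps sum_subtractf sum_distrib_left)
      then show ?thesis using wP[OF that] w1 by simp
    qed
    have idem': "(\<Sum>l<n. P' i l * P' l j) = P' i j" if "i < n" "j < n" for i j
    proof -
      have "(\<Sum>l<n. P' i l * P' l j)
          = (\<Sum>l<n. P i l * P' l j) - w i * (\<Sum>l<n. cnj (w l) * P' l j)"
        by (simp add: P'_def[of i] algebra_simps sum_subtractf sum_distrib_left)
      also have "\<dots> = (\<Sum>l<n. P i l * P l j) - (\<Sum>l<n. P i l * w l) * cnj (w j)"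
        using wP'[OF that(2)]
        by (simp add: P'_def algebra_simps sum_subtractf sum_distrib_left)
      finally show ?thesis using idem[OF that] Pw[OF that(1)] by (simp add: P'_def)
    qed
    have "{i. i < n \<and> P' i i \<noteq> 0} \<subset> {i. i < n \<and> P i i \<noteq> 0}"
    proof
      show "{i. i < n \<and> P' i i \<noteq> 0} \<subseteq> {i. i < n \<and> P i i \<noteq> 0}"
        using row_zero c(1) by (auto simp: P'_def w_def)
      have "P' c c = 0" unfolding P'_def using ww[OF c(1) c(1)] Pcc d by simp
      then show "{i. i < n \<and> P' i i \<noteq> 0} \<noteq> {i. i < n \<and> P i i \<noteq> 0}" using c by auto
    qed
    then have "card {i. i < n \<and> P' i i \<noteq> 0} < card {i. i < n \<and> P i i \<noteq> 0}"
      by (intro psubset_card_mono) auto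
    moreover have "\<forall>i<n. \<forall>j<n. P' j i = cnj (P' i j)" using herm' by blast
    moreover have "\<forall>i<n. \<forall>j<n. (\<Sum>l<n. P' i l * P' l j) = P' i j" using idem' by blast
    ultimately have "\<exists>(k :: nat) v. (\<forall>i<n. \<forall>j<n. P' i j = (\<Sum>a<k. v a i * cnj (v a j))) \<and>
      (\<forall>a<k. \<forall>b<k. (\<Sum>i<n. v a i * cnj (v b i)) = (if a = b then 1 else 0 :: complex))"
      by (rule less.hyps)
    then obtain k :: nat and v where
      dec: "\<forall>i<n. \<forall>j<n. P' i j = (\<Sum>a<k. v a i * cnj (v a j))" and
      orth: "\<forall>a<k. \<forall>b<k. (\<Sum>i<n. v a i * cnj (v b i)) = (if a = b then 1 else 0)"
      by (elim exE conjE) (rule that)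
    have P'v: "(\<Sum>j<n. P' i j * v b j) = v b i" if "i < n" "b < k" for i b
    proof -
      have "(\<Sum>j<n. P' i j * v b j) = (\<Sum>j<n. \<Sum>a<k. v a i * (v b j * cnj (v a j)))"
        using dec that(1) by (intro sum.cong refl) (simp add: sum_distrib_left mult_ac)
      also have "\<dots> = (\<Sum>a<k. v a i * (\<Sum>j<n. v b j * cnj (v a j)))"
        by (subst sum.swap) (simp add: sum_distrib_left)
      also have "\<dots> = (\<Sum>a<k. if b = a then v a i else 0)"
        using orth that(2) by (intro sum.cong refl) auto
      finally show ?thesis using that(2) by simp
    qed
    \<comment> \<open>Vectors fixed by \<open>P'\<close> are orthogonal to \<open>w\<close>, because \<open>P'\<close> annihilates \<open>w\<close>.\<close>
    have wv: "(\<Sum>i<n. cnj (w i) * v b i) = 0" if "b < k" for b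
    proof -
      have "(\<Sum>i<n. cnj (w i) * v b i) = (\<Sum>i<n. \<Sum>j<n. cnj (w i) * P' i j * v b j)"
        by (intro sum.cong refl) (use P'v that in \<open>simp add: mult.assoc flip: sum_distrib_left\<close>)
      also have "\<dots> = (\<Sum>j<n. (\<Sum>i<n. cnj (w i) * P' i j) * v b j)"
        by (subst sum.swap) (simp add: sum_distrib_right)
      also have "\<dots> = 0" using wP' by simp
      finally show ?thesis .
    qed
    have vw: "(\<Sum>i<n. v b i * cnj (w i)) = 0" "(\<Sum>i<n. w i * cnj (v b i)) = 0" if "b < k" for b
    proof -
      show 1: "(\<Sum>i<n. v b i * cnj (w i)) = 0" using wv[OF that] by (simp add: mult.commute)
      have "(\<Sum>i<n. w i * cnj (v b i)) = cnj (\<Sum>i<n. v b i * cnj (w i))"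
        by (simp add: mult.commute)
      then show "(\<Sum>i<n. w i * cnj (v b i)) = 0" using 1 by simp
    qed
    show ?thesis
    proof (intro exI conjI allI impI)
      fix i j assume ij: "i < n" "j < n"
      have "P i j = P' i j + w i * cnj (w j)" by (simp add: P'_def)
      then show "P i j = (\<Sum>a<Suc k. (v(k := w)) a i * cnj ((v(k := w)) a j))"
        using dec ij by simp
    next
      fix a b assume "a < Suc k" "b < Suc k"
      then show "(\<Sum>i<n. (v(k := w)) a i * cnj ((v(k := w)) b i)) = (if a = b then 1 else 0)"
        using orth vw w1 by (auto simp: less_Suc_eq mult.commute)
    qed
  qed
qed

text \<open>
  Polarization: testing against standard basis vectors kills the diagonal, and testing against
  \<open>e\<^sub>a + t e\<^sub>b\<close> for \<open>t = 1\<close> and \<open>t = \<i>\<close> then kills the two mixed coefficients.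
\<close>
lemma sesquilinear_form_zero:
  fixes D :: "nat \<Rightarrow> nat \<Rightarrow> complex"
  assumes zero: "\<And>x :: nat \<Rightarrow> complex. (\<Sum>a<k. \<Sum>b<k. x a * cnj (x b) * D a b) = 0"
    and ab: "a < k" "b < k"
  shows "D a b = 0"
proof -
  have diag: "D c c = 0" if "c < k" for c
  proof -
    define x :: "nat \<Rightarrow> complex" where "x a = (if a = c then 1 else 0)" for a
    have "(\<Sum>a<k. \<Sum>b<k. x a * cnj (x b) * D a b) = (\<Sum>a<k. if a = c then D a c else 0)"
    proof (intro sum.cong refl)
      fix a
      have "(\<Sum>b<k. x a * cnj (x b) * D a b) = (\<Sum>b<k. if b = c then x a * D a c else 0)"
        by (intro sum.cong refl) (simp add: x_def)
      then show "(\<Sum>b<k. x a * cnj (x b) * D a b) = (if a = c then D a c else 0)"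
        using that by (simp add: x_def)
    qed
    then show ?thesis using zero[of x] that by simp
  qed
  show ?thesis
  proof (cases "a = b")
    case True
    then show ?thesis using diag ab by simp
  next
    case False
    have mixed: "cnj t * D a b + t * D b a = 0" for t
    proof -
      define x where "x c = (if c = a then 1 else 0) + (if c = b then t else 0)" for c
      have x: "x a = 1" "x b = t" "\<And>c. c \<noteq> a \<Longrightarrow> c \<noteq> b \<Longrightarrow> x c = 0"
        using False by (auto simp: x_def)
      have two: "(\<Sum>c<k. h c) = h a + h b" if "\<And>c. c \<noteq> a \<Longrightarrow> c \<noteq> b \<Longrightarrow> h c = 0"
        for h :: "nat \<Rightarrow> complex"
      proof -
        have "sum h {..<k} = sum h {a, b}"
          using ab that by (intro sum.mono_neutral_right) auto
        then show ?thesis using False by simp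
      qed
      have "(\<Sum>c<k. \<Sum>c'<k. x c * cnj (x c') * D c c')
          = (\<Sum>c<k. x c * cnj (x a) * D c a + x c * cnj (x b) * D c b)"
        by (intro sum.cong refl two) (simp add: x)
      also have "\<dots> = x a * cnj (x a) * D a a + x a * cnj (x b) * D a b
          + (x b * cnj (x a) * D b a + x b * cnj (x b) * D b b)"
        by (rule two) (simp add: x)
      finally show ?thesis using zero[of x] diag ab by (simp add: x)
    qed
    from mixed[of 1] mixed[of \<i>] have "D a b = D b a" "D a b + D b a = 0" by auto
    then show ?thesis by simp
  qed
qed

section \<open>Gram matrices of Parseval frames\<close>

lemma mat_adjoint_eq_self_iff:
  fixes Q :: "complex mat"
  assumes "Q \<in> carrier_mat n n"
  shows "mat_adjoint Q = Q \<longleftrightarrow> (\<forall>i<n. \<forall>j<n. Q $$ (j, i) = cnj (Q $$ (i, j)))"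
proof -
  have entry: "mat_adjoint Q $$ (i, j) = cnj (Q $$ (j, i))" if "i < n" "j < n" for i j
    using assms that by (simp add: mat_adjoint_def mat_of_rows_def cols_def)
  have dims: "dim_row (mat_adjoint Q) = n" "dim_col (mat_adjoint Q) = n"
    using assms by (auto simp: mat_adjoint_def)
  show ?thesis
  proof
    assume "mat_adjoint Q = Q"
    then show "\<forall>i<n. \<forall>j<n. Q $$ (j, i) = cnj (Q $$ (i, j))" using entry by metis
  next
    assume "\<forall>i<n. \<forall>j<n. Q $$ (j, i) = cnj (Q $$ (i, j))"
    with entry have "mat_adjoint Q $$ (i, j) = Q $$ (i, j)" if "i < n" "j < n" for i j
      using that by metis
    then show "mat_adjoint Q = Q" using dims assms by (intro eq_matI) auto
  qed
qed

lemma cscalar_prod_sum: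
  fixes x y :: "complex vec"
  assumes "x \<in> carrier_vec k" "y \<in> carrier_vec k"
  shows "x \<bullet>c y = (\<Sum>a<k. x $ a * cnj (y $ a))"
  using assms by (simp add: scalar_prod_def lessThan_atLeast0)

lemma cscalar_prod_self:
  assumes "x \<in> carrier_vec k"
  shows "x \<bullet>c x = of_real ((cvec_norm x)\<^sup>2)"
proof -
  have eq: "x \<bullet>c x = of_real (\<Sum>a<k. (cmod (x $ a))\<^sup>2)"
    unfolding of_real_sum complex_norm_square using cscalar_prod_sum[OF assms assms] by simp
  then have "Re (x \<bullet>c x) = (\<Sum>a<k. (cmod (x $ a))\<^sup>2)" by simp
  moreover from this have "Re (x \<bullet>c x) \<ge> 0" by (simp add: sum_nonneg)
  ultimately show ?thesis using eq by (simp add: cvec_norm_def)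
qed

text \<open>
  The Parseval identity is the vanishing of the quadratic form of the defect \<open>D\<close>, the difference between
  the frame operator and the identity.  By polarization this forces \<open>D = 0\<close>, which says that
  the \<open>k\<close> coordinate sequences of the frame are orthonormal in complex \<open>n\<close>-space.
\<close>
lemma parseval_frame_iff_orthonormal_coordinates:
  assumes f: "\<forall>j<n. f j \<in> carrier_vec k"
  shows "parseval_frame n k f \<longleftrightarrow>
    (\<forall>a<k. \<forall>b<k. (\<Sum>j<n. cnj (f j $ a) * f j $ b) = (if a = b then 1 else 0))"
    (is "_ \<longleftrightarrow> ?orth")
proof -
  define D where "D a b = (\<Sum>j<n. cnj (f j $ a) * f j $ b) - (if a = b then 1 else 0)" for a b
  have defect: "(\<Sum>a<k. \<Sum>b<k. x $ a * cnj (x $ b) * D a b)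
      = of_real ((\<Sum>j<n. (cmod (x \<bullet>c f j))\<^sup>2) - (cvec_norm x)\<^sup>2)"
    if x: "x \<in> carrier_vec k" for x
  proof -
    have "(\<Sum>j<n. (of_real ((cmod (x \<bullet>c f j))\<^sup>2) :: complex))
        = (\<Sum>j<n. \<Sum>a<k. \<Sum>b<k. x $ a * cnj (x $ b) * (cnj (f j $ a) * f j $ b))"
    proof (intro sum.cong refl)
      fix j assume "j \<in> {..<n}"
      then have "x \<bullet>c f j = (\<Sum>a<k. x $ a * cnj (f j $ a))"
        using f x cscalar_prod_sum by auto
      then show "of_real ((cmod (x \<bullet>c f j))\<^sup>2)
          = (\<Sum>a<k. \<Sum>b<k. x $ a * cnj (x $ b) * (cnj (f j $ a) * f j $ b))"
        unfolding complex_norm_square by (simp add: sum_product mult_ac)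
    qed
    also have "\<dots> = (\<Sum>a<k. \<Sum>j<n. \<Sum>b<k. x $ a * cnj (x $ b) * (cnj (f j $ a) * f j $ b))"
      by (rule sum.swap)
    also have "\<dots> = (\<Sum>a<k. \<Sum>b<k. \<Sum>j<n. x $ a * cnj (x $ b) * (cnj (f j $ a) * f j $ b))"
      by (intro sum.cong refl sum.swap)
    also have "\<dots> = (\<Sum>a<k. \<Sum>b<k. x $ a * cnj (x $ b) * (\<Sum>j<n. cnj (f j $ a) * f j $ b))"
      by (simp only: sum_distrib_left)
    finally have lhs: "of_real (\<Sum>j<n. (cmod (x \<bullet>c f j))\<^sup>2) = \<dots>" by simp
    have "of_real ((cvec_norm x)\<^sup>2) = (\<Sum>a<k. x $ a * cnj (x $ a))"
      using cscalar_prod_self[OF x] cscalar_prod_sum[OF x x] by simp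
    also have "\<dots> = (\<Sum>a<k. \<Sum>b<k. x $ a * cnj (x $ b) * (if a = b then 1 else 0))"
      by (simp add: if_distrib[of "\<lambda>z. _ * z"] cong: if_cong)
    finally show ?thesis using lhs
      by (simp add: D_def right_diff_distrib sum_subtractf)
  qed
  show ?thesis
  proof
    assume pars: "parseval_frame n k f"
    have "(\<Sum>a<k. \<Sum>b<k. x a * cnj (x b) * D a b) = 0" for x
    proof -
      have "(\<Sum>a<k. \<Sum>b<k. x a * cnj (x b) * D a b)
          = (\<Sum>a<k. \<Sum>b<k. vec k x $ a * cnj (vec k x $ b) * D a b)" by simp
      also have "\<dots> = 0" using pars defect[of "vec k x"] by (simp add: parseval_frame_def)
      finally show ?thesis .
    qed
    then have "D a b = 0" if "a < k" "b < k" for a b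
      using that by (rule sesquilinear_form_zero)
    then show ?orth by (simp add: D_def)
  next
    assume ?orth
    then have zero: "(\<Sum>a<k. \<Sum>b<k. x $ a * cnj (x $ b) * D a b) = 0" for x :: "complex vec"
      by (simp add: D_def)
    have "(\<Sum>j<n. (cmod (x \<bullet>c f j))\<^sup>2) = (cvec_norm x)\<^sup>2"
      if "x \<in> carrier_vec k" for x
      using defect[OF that, unfolded zero] by (metis of_real_eq_0_iff right_minus_eq)
    then show "parseval_frame n k f" using f by (simp add: parseval_frame_def)
  qed
qed

lemma parseval_gram_idempotent:
  assumes pars: "parseval_frame n k f" and ij: "i < n" "j < n"
  shows "(\<Sum>l<n. gram_mat n f $$ (i, l) * gram_mat n f $$ (l, j)) = gram_mat n f $$ (i, j)"
proof -
  have f: "\<forall>j<n. f j \<in> carrier_vec k" using pars by (simp add: parseval_frame_def)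
  have orth: "(\<Sum>j<n. cnj (f j $ a) * f j $ b) = (if a = b then 1 else 0)"
    if "a < k" "b < k" for a b
    using parseval_frame_iff_orthonormal_coordinates[OF f] pars that by blast
  have gram: "gram_mat n f $$ (i, j) = (\<Sum>a<k. f j $ a * cnj (f i $ a))"
    if "i < n" "j < n" for i j
    using that f by (simp add: gram_mat_def cscalar_prod_sum[where k = k])
  have "(\<Sum>l<n. gram_mat n f $$ (i, l) * gram_mat n f $$ (l, j))
      = (\<Sum>l<n. (\<Sum>a<k. f l $ a * cnj (f i $ a)) * (\<Sum>b<k. f j $ b * cnj (f l $ b)))"
    using gram ij by (intro sum.cong refl) simp
  also have "\<dots> = (\<Sum>l<n. \<Sum>a<k. \<Sum>b<k.
      (cnj (f i $ a) * f j $ b) * (cnj (f l $ b) * f l $ a))"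
    unfolding sum_product by (intro sum.cong refl) simp
  also have "\<dots> = (\<Sum>a<k. \<Sum>l<n. \<Sum>b<k.
      (cnj (f i $ a) * f j $ b) * (cnj (f l $ b) * f l $ a))"
    by (rule sum.swap)
  also have "\<dots> = (\<Sum>a<k. \<Sum>b<k. \<Sum>l<n.
      (cnj (f i $ a) * f j $ b) * (cnj (f l $ b) * f l $ a))"
    by (intro sum.cong refl sum.swap)
  also have "\<dots> = (\<Sum>a<k. \<Sum>b<k. cnj (f i $ a) * f j $ b * (\<Sum>l<n. cnj (f l $ b) * f l $ a))"
    by (simp only: sum_distrib_left)
  also have "\<dots> = (\<Sum>a<k. \<Sum>b<k. if b = a then cnj (f i $ a) * f j $ b else 0)"
    by (intro sum.cong refl) (simp add: orth)
  also have "\<dots> = gram_mat n f $$ (i, j)"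
    using gram[OF ij] by (simp add: mult.commute)
  finally show ?thesis .
qed

text \<open>
  The frame is found by transposition: an orthonormal family spanning the range of the projection,
  written as \<open>k\<close> rows of length \<open>n\<close>, has the (conjugated) frame vectors as its columns.
\<close>
lemma hermitian_idempotent_is_parseval_gram:
  fixes P :: "complex mat"
  assumes P: "P \<in> carrier_mat n n"
    and herm: "\<forall>i<n. \<forall>j<n. P $$ (j, i) = cnj (P $$ (i, j))"
    and idem: "\<forall>i<n. \<forall>j<n. (\<Sum>l<n. P $$ (i, l) * P $$ (l, j)) = P $$ (i, j)"
  obtains k f where "parseval_frame n k f" "gram_mat n f = P"
    "(\<Sum>i<n. P $$ (i, i)) = of_nat k"
proof -
  obtain k :: nat and v where
    dec: "\<forall>i<n. \<forall>j<n. P $$ (i, j) = (\<Sum>a<k. v a i * cnj (v a j))" and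
    orth: "\<forall>a<k. \<forall>b<k. (\<Sum>i<n. v a i * cnj (v b i)) = (if a = b then 1 else 0 :: complex)"
    using hermitian_idempotent_orthonormal_decomposition[of n "\<lambda>i j. P $$ (i, j)", OF herm idem]
    by (elim exE conjE) (rule that)
  define f where "f j = vec k (\<lambda>a. cnj (v a j))" for j
  have f: "\<forall>j<n. f j \<in> carrier_vec k" by (simp add: f_def)
  have "parseval_frame n k f"
    unfolding parseval_frame_iff_orthonormal_coordinates[OF f] using orth by (simp add: f_def)
  moreover have "gram_mat n f = P"
  proof (rule eq_matI)
    fix i j assume "i < dim_row P" "j < dim_col P"
    then have ij: "i < n" "j < n" using P by auto
    then show "gram_mat n f $$ (i, j) = P $$ (i, j)"
      using f by (simp add: gram_mat_def cscalar_prod_sum[where k = k] dec) (simp add: f_def mult.commute)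
  qed (use P in \<open>auto simp: gram_mat_def\<close>)
  moreover have "(\<Sum>i<n. P $$ (i, i)) = of_nat k"
  proof -
    have "(\<Sum>i<n. P $$ (i, i)) = (\<Sum>a<k. \<Sum>i<n. v a i * cnj (v a i))"
      by (subst sum.swap) (simp add: dec)
    then show ?thesis by (simp add: orth)
  qed
  ultimately show ?thesis by (rule that)
qed

section \<open>The quadratic equation of a signature matrix\<close>

text \<open>
  A signature matrix satisfies \<open>x\<^sup>2 = \<mu> x + (n - 1)\<close>, where the coefficient \<open>\<mu>\<close> given here is the sum
  of the two roots, its possible eigenvalues.
\<close>
definition eigenvalue_sum :: "nat \<Rightarrow> nat \<Rightarrow> real" where
  "eigenvalue_sum n k = (real n - 2 * real k) * sqrt ((real n - 1) / (real k * (real n - real k)))"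

lemma frame_const_pos:
  assumes "1 \<le> k" "k < n"
  shows "frame_const n k > 0"
  using assms unfolding frame_const_def by (intro real_sqrt_gt_zero divide_pos_pos mult_pos_pos) auto

lemma frame_const_square:
  assumes "1 \<le> k" "k < n"
  shows "(real n - 1) * (frame_const n k)\<^sup>2 = real k / real n * (1 - real k / real n)"
proof -
  have "(frame_const n k)\<^sup>2 = real k * (real n - real k) / ((real n)\<^sup>2 * (real n - 1))"
    unfolding frame_const_def using assms by (intro real_sqrt_pow2 divide_nonneg_nonneg) auto
  then show ?thesis using assms by (simp add: power2_eq_square field_simps)
qed

lemma frame_const_eigenvalue_sum:
  assumes "1 \<le> k" "k < n"
  shows "frame_const n k * eigenvalue_sum n k = 1 - 2 * (real k / real n)"
proof -
  define p where "p = real k * (real n - real k)"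
  have p: "p > 0" "real n - 1 > 0" using assms by (auto simp: p_def)
  then have "p / ((real n)\<^sup>2 * (real n - 1)) * ((real n - 1) / p) = (1 / real n)\<^sup>2"
    by (simp add: power2_eq_square)
  then have "frame_const n k * sqrt ((real n - 1) / p) = 1 / real n"
    unfolding frame_const_def p_def[symmetric] by (simp flip: real_sqrt_mult)
  moreover have "frame_const n k * eigenvalue_sum n k
      = (real n - 2 * real k) * (frame_const n k * sqrt ((real n - 1) / p))"
    by (simp add: eigenvalue_sum_def p_def)
  ultimately have "frame_const n k * eigenvalue_sum n k = (real n - 2 * real k) * (1 / real n)"
    by (simp only:)
  also have "\<dots> = 1 - 2 * (real k / real n)" using assms by (simp add: field_simps)
  finally show ?thesis .
qed

text \<open>
  With \<open>a = k/n\<close>, the relations \<open>c \<mu> = 1 - 2 a\<close> and \<open>(n - 1) c\<^sup>2 = a (1 - a)\<close> identify the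
  discriminant \<open>4 (n - 1) + \<mu>\<^sup>2\<close> of the quadratic equation as \<open>1 / c\<^sup>2\<close>, and \<open>k\<close> is recovered from
  \<open>c \<mu>\<close>.
\<close>
lemma eigenvalue_sum_inverse:
  assumes "1 \<le> k" "k < n"
  shows "real k = real n / 2
    - eigenvalue_sum n k * real n / (2 * sqrt (4 * (real n - 1) + (eigenvalue_sum n k)\<^sup>2))"
proof -
  define c \<mu> a where "c = frame_const n k" and "\<mu> = eigenvalue_sum n k" and "a = real k / real n"
  have c: "c > 0" using frame_const_pos[OF assms] by (simp add: c_def)
  have c2: "(real n - 1) * c\<^sup>2 = a * (1 - a)" using frame_const_square[OF assms] by (simp add: c_def a_def)
  have cmu: "c * \<mu> = 1 - 2 * a"
    using frame_const_eigenvalue_sum[OF assms] by (simp add: c_def \<mu>_def a_def)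
  have "(c * \<mu>)\<^sup>2 = (1 - 2 * a)\<^sup>2" using cmu by simp
  then have "c\<^sup>2 * (4 * (real n - 1) + \<mu>\<^sup>2) = 1"
    using c2 by (simp add: power_mult_distrib algebra_simps power2_eq_square)
  then have "4 * (real n - 1) + \<mu>\<^sup>2 = (1 / c)\<^sup>2" using c by (simp add: field_simps)
  then have "sqrt (4 * (real n - 1) + \<mu>\<^sup>2) = 1 / c" using c by simp
  then have "\<mu> * real n / (2 * sqrt (4 * (real n - 1) + \<mu>\<^sup>2)) = (c * \<mu>) * real n / 2" by simp
  also have "\<dots> = real n / 2 - real k"
    unfolding cmu using assms by (simp add: a_def field_simps)
  finally show ?thesis by (simp add: \<mu>_def)
qed

lemma sum_square_shifted:
  fixes Q :: "nat \<Rightarrow> nat \<Rightarrow> complex"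
  assumes "i < n" "j < n"
  shows "(\<Sum>l<n. (a * of_bool (i = l) + c * Q i l) * (a * of_bool (l = j) + c * Q l j))
    = a\<^sup>2 * of_bool (i = j) + 2 * a * c * Q i j + c\<^sup>2 * (\<Sum>l<n. Q i l * Q l j)"
proof -
  have "(\<Sum>l<n. (a * of_bool (i = l) + c * Q i l) * (a * of_bool (l = j) + c * Q l j))
    = (\<Sum>l<n. (if i = l then a\<^sup>2 * of_bool (l = j) + a * c * Q l j else 0)
      + (if l = j then a * c * Q i l else 0) + c\<^sup>2 * (Q i l * Q l j))"
    by (intro sum.cong refl) (simp add: of_bool_def algebra_simps power2_eq_square)
  also have "\<dots> = a\<^sup>2 * of_bool (i = j) + 2 * a * c * Q i j + c\<^sup>2 * (\<Sum>l<n. Q i l * Q l j)"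
    using assms by (simp add: sum.distrib sum_distrib_left)
  finally show ?thesis .
qed

text \<open>
  The Gram matrix is idempotent; comparing the coefficients of \<open>I\<close> and \<open>Q\<close> in the square of
  \<open>a I + c Q\<close> gives \<open>c\<^sup>2 Q\<^sup>2 = (a - a\<^sup>2) I + c (1 - 2 a) Q\<close>, where \<open>c\<close> can be cancelled.
\<close>
lemma signature_matrix_square:
  assumes sig: "signature_matrix n k Q" and ij: "i < n" "j < n"
  shows "(\<Sum>l<n. Q $$ (i, l) * Q $$ (l, j))
    = of_real (real n - 1) * of_bool (i = j) + of_real (eigenvalue_sum n k) * Q $$ (i, j)"
proof -
  have k: "1 \<le> k" "k < n" and Q: "Q \<in> carrier_mat n n"
    using sig by (auto simp: signature_matrix_def)
  define a c :: complex where "a = of_real (real k / real n)" and "c = of_real (frame_const n k)"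
  obtain f where f: "parseval_frame n k f" and gram: "gram_mat n f = a \<cdot>\<^sub>m 1\<^sub>m n + c \<cdot>\<^sub>m Q"
    using sig by (auto simp: signature_matrix_def equiangular_frame_def a_def c_def)
  have entry: "gram_mat n f $$ (i, j) = a * of_bool (i = j) + c * Q $$ (i, j)"
    if "i < n" "j < n" for i j
    using that Q by (simp add: gram)
  have c0: "c \<noteq> 0" using frame_const_pos[OF k] by (simp add: c_def)
  have c2: "a - a\<^sup>2 = c\<^sup>2 * of_real (real n - 1)"
    using arg_cong[OF frame_const_square[OF k], of complex_of_real]
    by (simp add: a_def c_def algebra_simps power2_eq_square)
  have cmu: "1 - 2 * a = c * of_real (eigenvalue_sum n k)"
    using arg_cong[OF frame_const_eigenvalue_sum[OF k], of complex_of_real]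
    by (simp add: a_def c_def)
  have "(\<Sum>l<n. (a * of_bool (i = l) + c * Q $$ (i, l)) * (a * of_bool (l = j) + c * Q $$ (l, j)))
      = a * of_bool (i = j) + c * Q $$ (i, j)"
    using parseval_gram_idempotent[OF f ij] ij by (simp add: entry)
  then have "c\<^sup>2 * (\<Sum>l<n. Q $$ (i, l) * Q $$ (l, j))
      = (a - a\<^sup>2) * of_bool (i = j) + c * (1 - 2 * a) * Q $$ (i, j)"
    unfolding sum_square_shifted[OF ij, of a c "\<lambda>i j. Q $$ (i, j)"] by (simp add: algebra_simps)
  also have "\<dots> = c\<^sup>2 * (of_real (real n - 1) * of_bool (i = j)
      + of_real (eigenvalue_sum n k) * Q $$ (i, j))"
    unfolding c2 cmu by (simp add: algebra_simps power2_eq_square)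
  finally show ?thesis using c0 by simp
qed

text \<open>
  The diagonal of the Gram matrix holds the squared lengths, so all frame vectors have
  length \<open>sqrt a\<close> and normalizing divides the inner products by \<open>a\<close>.
\<close>
lemma gram_equiangular:
  assumes pars: "parseval_frame n k f" and a: "a > 0"
    and diag: "\<And>i. i < n \<Longrightarrow> gram_mat n f $$ (i, i) = of_real a"
    and off: "\<And>i j. i < n \<Longrightarrow> j < n \<Longrightarrow> i \<noteq> j \<Longrightarrow> cmod (gram_mat n f $$ (i, j)) = c"
  shows "equiangular_frame n k f"
proof -
  have f: "f i \<in> carrier_vec k" if "i < n" for i using pars that by (simp add: parseval_frame_def)
  have norm: "(cvec_norm (f i))\<^sup>2 = a" if "i < n" for i
    using diag[OF that] cscalar_prod_self[OF f[OF that]] that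
    by (metis gram_mat_def index_mat(1) of_real_eq_iff prod.simps(2))
  have nz: "f i \<noteq> 0\<^sub>v k" if "i < n" for i
  proof
    assume "f i = 0\<^sub>v k"
    then have "f i \<bullet>c f i = 0" by simp
    then show False using norm[OF that] a cscalar_prod_self[OF f[OF that]] by simp
  qed
  have "cmod (cvec_normalize (f i) \<bullet>c cvec_normalize (f j)) = c / a"
    if ij: "i < n" "j < n" "i \<noteq> j" for i j
  proof -
    have abs: "\<bar>cvec_norm (f l)\<bar> = sqrt a" if "l < n" for l
      using norm[OF that] by (metis real_sqrt_abs)
    have "cvec_normalize (f i) \<bullet>c cvec_normalize (f j)
        = of_real (1 / cvec_norm (f i)) * of_real (1 / cvec_norm (f j)) * (f i \<bullet>c f j)"
      using f[OF ij(1)] f[OF ij(2)] by (simp add: cvec_normalize_def cscalar_prod_sum[where k = k] sum_distrib_left mult_ac sum_divide_distrib)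
    moreover have "cmod (f i \<bullet>c f j) = c"
      using off[of j i] ij by (simp add: gram_mat_def)
    ultimately show ?thesis using abs ij a by (simp add: norm_mult norm_divide)
  qed
  then show ?thesis using pars nz unfolding equiangular_frame_def by blast
qed

text \<open>
  The roots of \<open>x\<^sup>2 = (n - 1) + \<mu> x\<close> have opposite signs and distance \<open>sqrt (4 (n - 1) + \<mu>\<^sup>2)\<close>, the
  inverse of \<open>c\<close>.  The spectral projection for the positive root is \<open>a I + c Q\<close>.  Its trace
  is the integer \<open>k = n a\<close>, and \<open>0 < a < 1\<close> places \<open>k\<close> strictly between \<open>0\<close> and \<open>n\<close>.
\<close>
lemma signature_matrixI:
  assumes n: "n \<ge> 2" and Q: "Q \<in> carrier_mat n n"
    and adj: "mat_adjoint Q = Q" and diag: "\<forall>i<n. Q $$ (i, i) = 0"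
    and unimod: "\<forall>i<n. \<forall>j<n. i \<noteq> j \<longrightarrow> cmod (Q $$ (i, j)) = 1"
    and square: "\<forall>i<n. \<forall>j<n. (\<Sum>l<n. Q $$ (i, l) * Q $$ (l, j))
      = of_real (real n - 1) * of_bool (i = j) + of_real \<mu> * Q $$ (i, j)"
  shows "\<exists>k. signature_matrix n k Q"
proof -
  define c where "c = 1 / sqrt (4 * (real n - 1) + \<mu>\<^sup>2)"
  define a where "a = (1 - \<mu> * c) / 2"
  have disc: "4 * (real n - 1) + \<mu>\<^sup>2 > 0"
    using n by (intro add_pos_nonneg) auto
  then have c: "c > 0" by (simp add: c_def)
  have c2: "c\<^sup>2 * (4 * (real n - 1) + \<mu>\<^sup>2) = 1"
    using disc by (simp add: c_def power_divide)
  have aa: "a * (1 - a) = c\<^sup>2 * (real n - 1)"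
    using c2 by (simp add: a_def field_simps power2_eq_square)
  then have "a * (1 - a) > 0" using c n by simp
  then have a: "0 < a" "a < 1" by (auto simp: zero_less_mult_iff)
  define P where "P = of_real a \<cdot>\<^sub>m 1\<^sub>m n + of_real c \<cdot>\<^sub>m Q"
  have P: "P \<in> carrier_mat n n" using Q by (simp add: P_def)
  have entry: "P $$ (i, j) = of_real a * of_bool (i = j) + of_real c * Q $$ (i, j)"
    if "i < n" "j < n" for i j
    using that Q by (simp add: P_def)
  have "\<forall>i<n. \<forall>j<n. P $$ (j, i) = cnj (P $$ (i, j))"
  proof (intro allI impI)
    fix i j assume ij: "i < n" "j < n"
    then have "Q $$ (j, i) = cnj (Q $$ (i, j))" using adj mat_adjoint_eq_self_iff[OF Q] by blast
    then show "P $$ (j, i) = cnj (P $$ (i, j))" using ij by (simp add: entry of_bool_def)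
  qed
  moreover have "\<forall>i<n. \<forall>j<n. (\<Sum>l<n. P $$ (i, l) * P $$ (l, j)) = P $$ (i, j)"
  proof (intro allI impI)
    fix i j assume ij: "i < n" "j < n"
    have "(\<Sum>l<n. P $$ (i, l) * P $$ (l, j))
      = (\<Sum>l<n. (of_real a * of_bool (i = l) + of_real c * Q $$ (i, l))
          * (of_real a * of_bool (l = j) + of_real c * Q $$ (l, j)))"
      using ij by (simp add: entry)
    also have "\<dots> = of_real (a\<^sup>2 + c\<^sup>2 * (real n - 1)) * of_bool (i = j)
        + of_real (c * (2 * a + c * \<mu>)) * Q $$ (i, j)"
      unfolding sum_square_shifted[OF ij, of "of_real a" "of_real c" "\<lambda>i j. Q $$ (i, j)"]
        square[rule_format, OF ij]
      by (simp add: algebra_simps power2_eq_square)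
    also have "a\<^sup>2 + c\<^sup>2 * (real n - 1) = a" using aa by (simp add: algebra_simps power2_eq_square)
    also have "2 * a + c * \<mu> = 1" by (simp add: a_def field_simps)
    finally show "(\<Sum>l<n. P $$ (i, l) * P $$ (l, j)) = P $$ (i, j)" using ij by (simp add: entry)
  qed
  ultimately obtain k f where f: "parseval_frame n k f" and gram: "gram_mat n f = P"
    and trace: "(\<Sum>i<n. P $$ (i, i)) = of_nat k"
    using hermitian_idempotent_is_parseval_gram[OF P] by blast
  have "(\<Sum>i<n. P $$ (i, i)) = of_real (real n * a)" using diag by (simp add: entry)
  with trace have na: "real n * a = real k"
    by (metis of_real_eq_iff of_real_of_nat_eq)
  then have ak: "a = real k / real n" using n by (simp add: field_simps)
  have k: "1 \<le> k" "k < n" using a n unfolding ak by (auto simp: field_simps)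
  have "(real n - 1) * (frame_const n k)\<^sup>2 = (real n - 1) * c\<^sup>2"
    using frame_const_square[OF k] aa by (simp add: ak mult.commute)
  then have "(frame_const n k)\<^sup>2 = c\<^sup>2" using n by simp
  \<comment> \<open>Both constants solve \<open>(n - 1) c\<^sup>2 = a (1 - a)\<close>, and both are positive.\<close>
  then have ck: "c = frame_const n k"
    using c frame_const_pos[OF k] by (simp add: power2_eq_iff_nonneg)
  have "equiangular_frame n k f"
  proof (rule gram_equiangular[OF f a(1)])
    fix i assume "i < n"
    then show "gram_mat n f $$ (i, i) = of_real a" using diag by (simp add: gram entry)
  next
    fix i j assume "i < n" "j < n" "i \<noteq> j"
    then show "cmod (gram_mat n f $$ (i, j)) = c" using unimod c by (simp add: gram entry norm_mult)
  qed
  then show ?thesis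
    using k Q adj diag unimod gram unfolding signature_matrix_def P_def ak ck by blast
qed

section \<open>Bordered cube root matrices of a group\<close>

lemma cube_omega_relations:
  shows cube_omega_square: "cube_omega\<^sup>2 = cnj cube_omega"
    and cube_omega_cube: "cube_omega * cube_omega\<^sup>2 = 1"
    and cube_omega_sum: "cube_omega + cube_omega\<^sup>2 = - 1"
    and cube_omega_ne: "cube_omega \<noteq> 1" "cube_omega\<^sup>2 \<noteq> 1" "cube_omega \<noteq> cube_omega\<^sup>2"
    and cmod_cube_omega: "cmod cube_omega = 1"
proof -
  show sq: "cube_omega\<^sup>2 = cnj cube_omega"
    by (simp add: cube_omega_def complex_eq_iff power2_eq_square)
  show "cube_omega * cube_omega\<^sup>2 = 1"
    unfolding sq by (simp add: cube_omega_def complex_eq_iff)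
  show "cube_omega + cube_omega\<^sup>2 = - 1"
    unfolding sq by (simp add: cube_omega_def complex_eq_iff)
  show "cube_omega \<noteq> 1" "cube_omega\<^sup>2 \<noteq> 1" "cube_omega \<noteq> cube_omega\<^sup>2"
    unfolding sq by (simp_all add: cube_omega_def complex_eq_iff)
  show "cmod cube_omega = 1"
    by (simp add: cube_omega_def cmod_def power2_eq_square)
qed

locale cube_root_partition = group G for G :: "('a, 'b) monoid_scheme" (structure) +
  fixes elt :: "nat \<Rightarrow> 'a" and m :: nat and S T V :: "'a set"
  assumes finite_carrier: "finite (carrier G)"
    and card_carrier: "card (carrier G) = m"
    and elt_bij: "bij_betw elt {0..<m} (carrier G)"
    and S_sub: "S \<subseteq> carrier G - {\<one>}" and T_sub: "T \<subseteq> carrier G - {\<one>}"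
    and ST_disjoint: "S \<inter> T = {}"
    and V_eq: "V = (carrier G - {\<one>}) - (S \<union> T)"
begin

text \<open>
  The function on the group whose left convolution operator has the matrix \<open>Q\<close>.
\<close>
definition symbol :: "'a \<Rightarrow> complex" where
  "symbol g = of_bool (g \<in> S) + cube_omega * of_bool (g \<in> T) + cube_omega\<^sup>2 * of_bool (g \<in> V)"

abbreviation Q :: "complex mat" where
  "Q \<equiv> cube_root_matrix G elt S T V"

abbreviation B :: "complex mat" where
  "B \<equiv> bordered_mat m Q"

abbreviation F :: "'a \<Rightarrow> complex" where
  "F \<equiv> cube_root_count G S T V"

lemma subsets: "S \<subseteq> carrier G" "T \<subseteq> carrier G" "V \<subseteq> carrier G"
  using S_sub T_sub V_eq by auto

lemma elt_closed: "i < m \<Longrightarrow> elt i \<in> carrier G"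
  using elt_bij by (auto simp: bij_betw_def)

lemma elt_surj:
  assumes "g \<in> carrier G"
  obtains i where "i < m" "elt i = g"
proof -
  have "g \<in> elt ` {0..<m}" using elt_bij assms by (simp add: bij_betw_def)
  then show ?thesis using that by auto
qed

lemma quotient_nontrivial:
  assumes "i < m" "j < m" "i \<noteq> j"
  shows "elt i \<otimes> inv elt j \<in> carrier G - {\<one>}"
proof -
  have "elt i \<noteq> elt j"
    using inj_on_eq_iff[OF bij_betw_imp_inj_on[OF elt_bij], of i j] assms by simp
  then show ?thesis using assms elt_closed inv_solve_right' by auto
qed

lemma sum_elt: "(\<Sum>l<m. h (elt l)) = (\<Sum>g\<in>carrier G. h g)"
  using sum.reindex_bij_betw[OF elt_bij] by (simp add: lessThan_atLeast0)

lemma symbol_simps: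
  shows symbol_one: "symbol \<one> = 0"
    and symbol_S: "g \<in> S \<Longrightarrow> symbol g = 1"
    and symbol_T: "g \<in> T \<Longrightarrow> symbol g = cube_omega"
    and symbol_V: "g \<in> V \<Longrightarrow> symbol g = cube_omega\<^sup>2"
proof -
  have "\<one> \<notin> S" "\<one> \<notin> T" "\<one> \<notin> V" "S \<inter> T = {}" "S \<inter> V = {}" "T \<inter> V = {}"
    using S_sub T_sub ST_disjoint V_eq by auto
  then show "symbol \<one> = 0" "g \<in> S \<Longrightarrow> symbol g = 1" "g \<in> T \<Longrightarrow> symbol g = cube_omega"
    "g \<in> V \<Longrightarrow> symbol g = cube_omega\<^sup>2"
    by (auto simp: symbol_def)
qed

lemma symbol_cases:
  assumes "g \<in> carrier G"
  obtains "g = \<one>" | "g \<in> S" | "g \<in> T" | "g \<in> V"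
  using assms V_eq by blast

lemma cmod_symbol: "g \<in> carrier G \<Longrightarrow> g \<noteq> \<one> \<Longrightarrow> cmod (symbol g) = 1"
  by (erule symbol_cases) (auto simp: symbol_simps cmod_cube_omega norm_power)

lemma left_regular_sum_entries:
  assumes A: "A \<subseteq> carrier G"
  shows "left_regular_sum G elt A \<in> carrier_mat m m"
    and "i < m \<Longrightarrow> j < m \<Longrightarrow>
      left_regular_sum G elt A $$ (i, j) = of_bool (elt i \<otimes> inv elt j \<in> A)"
proof -
  interpret M: abelian_group "module_mat TYPE(complex) m m" by (rule abelian_group_mat)
  have "finite A" using A finite_carrier finite_subset by blast
  then have "left_regular_sum G elt A \<in> carrier_mat m m \<and> (i < m \<longrightarrow> j < m \<longrightarrow>
      left_regular_sum G elt A $$ (i, j) = of_bool (elt i \<otimes> inv elt j \<in> A))"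
    using A unfolding left_regular_sum_def card_carrier
  proof (induction A rule: finite_induct)
    case empty
    then show ?case using M.finsum_empty by (simp add: module_mat_simps)
  next
    case (insert g A)
    have reg: "left_regular G elt h \<in> carrier_mat m m" for h
      by (simp add: left_regular_def card_carrier)
    have split: "finsum (module_mat TYPE(complex) m m) (left_regular G elt) (insert g A)
        = left_regular G elt g + finsum (module_mat TYPE(complex) m m) (left_regular G elt) A"
      using M.finsum_insert[OF insert.hyps, of "left_regular G elt"] reg
      by (simp add: module_mat_simps)
    have IH: "finsum (module_mat TYPE(complex) m m) (left_regular G elt) A \<in> carrier_mat m m"
      "i < m \<Longrightarrow> j < m \<Longrightarrow>
        finsum (module_mat TYPE(complex) m m) (left_regular G elt) A $$ (i, j)
          = of_bool (elt i \<otimes> inv elt j \<in> A)"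
      using insert by auto
    have "left_regular G elt g $$ (i, j) = of_bool (elt i \<otimes> inv elt j = g)" if "i < m" "j < m"
    proof -
      have "elt i = g \<otimes> elt j \<longleftrightarrow> elt i \<otimes> inv elt j = g"
        using that insert.prems elt_closed inv_solve_right' by auto
      then show ?thesis using that by (simp add: left_regular_def card_carrier)
    qed
    with IH reg[of g] insert.hyps show ?case unfolding split
      by (auto simp: of_bool_def carrier_matD)
  qed
  then show "left_regular_sum G elt A \<in> carrier_mat m m"
    and "i < m \<Longrightarrow> j < m \<Longrightarrow>
      left_regular_sum G elt A $$ (i, j) = of_bool (elt i \<otimes> inv elt j \<in> A)" by auto
qed

lemma Q_carrier: "Q \<in> carrier_mat m m"
  using left_regular_sum_entries(1) subsets by (simp add: cube_root_matrix_def)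

lemma Q_entry: "i < m \<Longrightarrow> j < m \<Longrightarrow> Q $$ (i, j) = symbol (elt i \<otimes> inv elt j)"
  using left_regular_sum_entries(1)[OF subsets(1)] left_regular_sum_entries(1)[OF subsets(2)]
    left_regular_sum_entries(1)[OF subsets(3)]
  by (simp add: cube_root_matrix_def symbol_def left_regular_sum_entries(2) subsets carrier_matD)

lemma B_carrier: "B \<in> carrier_mat (Suc m) (Suc m)"
  using four_block_carrier_mat[OF zero_carrier_mat Q_carrier, of 1 1] by (simp add: bordered_mat_def Let_def)

lemma B_entries:
  shows "B $$ (0, 0) = 0"
    and "j < m \<Longrightarrow> B $$ (0, Suc j) = 1"
    and "i < m \<Longrightarrow> B $$ (Suc i, 0) = 1"
    and "i < m \<Longrightarrow> j < m \<Longrightarrow> B $$ (Suc i, Suc j) = symbol (elt i \<otimes> inv elt j)"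
  using Q_carrier by (auto simp: bordered_mat_def Let_def Q_entry carrier_matD)

lemma B_diagonal: "i < Suc m \<Longrightarrow> B $$ (i, i) = 0"
  by (cases i) (auto simp: B_entries symbol_one elt_closed)

lemma B_unimodular:
  assumes "i < Suc m" "j < Suc m" "i \<noteq> j"
  shows "cmod (B $$ (i, j)) = 1"
proof (cases "i = 0 \<or> j = 0")
  case True
  then show ?thesis using assms by (cases i; cases j) (auto simp: B_entries)
next
  case False
  then obtain i' j' where ij: "i = Suc i'" "j = Suc j'" "i' < m" "j' < m" "i' \<noteq> j'"
    using assms by (cases i; cases j) auto
  then have "elt i' \<otimes> inv elt j' \<in> carrier G - {\<one>}" using quotient_nontrivial by simp
  then show ?thesis using ij by (simp add: B_entries cmod_symbol)
qed

lemma symbol_eq_iff: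
  assumes "g \<in> carrier G"
  shows "(symbol g = 1 \<longleftrightarrow> g \<in> S) \<and> (symbol g = cube_omega \<longleftrightarrow> g \<in> T) \<and>
    (symbol g = cube_omega\<^sup>2 \<longleftrightarrow> g \<in> V)"
  using assms
proof (cases rule: symbol_cases)
  case 1
  moreover have "\<one> \<notin> S" "\<one> \<notin> T" "\<one> \<notin> V" using S_sub T_sub V_eq by auto
  moreover have "cube_omega \<noteq> 0" using cmod_cube_omega by auto
  ultimately show ?thesis by (simp add: symbol_one)
next
  case 2
  moreover have "g \<notin> T" "g \<notin> V" using 2 ST_disjoint V_eq by auto
  ultimately show ?thesis using cube_omega_ne by (simp add: symbol_S)
next
  case 3
  moreover have "g \<notin> S" "g \<notin> V" using 3 ST_disjoint V_eq by auto
  ultimately show ?thesis using cube_omega_ne by (simp add: symbol_T)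
next
  case 4
  moreover have "g \<notin> S" "g \<notin> T" using 4 V_eq by auto
  ultimately show ?thesis using cube_omega_ne by (simp add: symbol_V)
qed

text \<open>
  Inversion must act on the values of the symbol as conjugation, which fixes \<open>1\<close> and swaps the two
  primitive cube roots.
\<close>
lemma symbol_hermitian_iff:
  "(\<forall>g\<in>carrier G. symbol (inv g) = cnj (symbol g)) \<longleftrightarrow> S = set_inv S \<and> set_inv T = V"
proof
  assume herm: "\<forall>g\<in>carrier G. symbol (inv g) = cnj (symbol g)"
  have S: "inv g \<in> S" if "g \<in> S" for g
  proof -
    have g: "g \<in> carrier G" using that subsets by blast
    then have "symbol (inv g) = 1" using herm that by (simp add: symbol_S)
    then show ?thesis using symbol_eq_iff[OF inv_closed[OF g]] by blast
  qed
  have T: "inv g \<in> V" if "g \<in> T" for g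
  proof -
    have g: "g \<in> carrier G" using that subsets by blast
    then have "symbol (inv g) = cube_omega\<^sup>2" using herm that by (simp add: symbol_T cube_omega_square)
    then show ?thesis using symbol_eq_iff[OF inv_closed[OF g]] by blast
  qed
  have V: "inv g \<in> T" if "g \<in> V" for g
  proof -
    have g: "g \<in> carrier G" using that subsets by blast
    then have "symbol (inv g) = cube_omega" using herm that by (simp add: symbol_V cube_omega_square)
    then show ?thesis using symbol_eq_iff[OF inv_closed[OF g]] by blast
  qed
  have member: "g \<in> set_inv A" if "inv g \<in> A" "g \<in> carrier G" for g A
    using that unfolding SET_INV_def by force
  have "set_inv S \<subseteq> S" "set_inv T \<subseteq> V" using S T by (auto simp: SET_INV_def)
  moreover have "S \<subseteq> set_inv S" "V \<subseteq> set_inv T" using S V member subsets by blast+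
  ultimately show "S = set_inv S \<and> set_inv T = V" by blast
next
  assume "S = set_inv S \<and> set_inv T = V"
  then have S: "set_inv S = S" and T: "set_inv T = V" by auto
  have "inv g \<in> S" if "g \<in> S" for g using S that by (auto simp: SET_INV_def)
  moreover have "inv g \<in> V" if "g \<in> T" for g using T that by (auto simp: SET_INV_def)
  moreover have "inv g \<in> T" if "g \<in> V" for g
    using T that subsets(2) by (auto simp: SET_INV_def)
  ultimately show "\<forall>g\<in>carrier G. symbol (inv g) = cnj (symbol g)"
    by (auto elim!: symbol_cases simp: symbol_simps cube_omega_square)
qed

lemma B_hermitian_iff: "mat_adjoint B = B \<longleftrightarrow> S = set_inv S \<and> set_inv T = V"
proof -
  have "mat_adjoint B = B \<longleftrightarrow> (\<forall>g\<in>carrier G. symbol (inv g) = cnj (symbol g))"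
  proof
    assume "mat_adjoint B = B"
    then have herm: "B $$ (Suc j, Suc i) = cnj (B $$ (Suc i, Suc j))" if "i < m" "j < m" for i j
      using mat_adjoint_eq_self_iff[OF B_carrier] that by blast
    show "\<forall>g\<in>carrier G. symbol (inv g) = cnj (symbol g)"
    proof
      fix g assume g: "g \<in> carrier G"
      obtain i where i: "i < m" "elt i = g" using elt_surj[OF g] .
      obtain j where j: "j < m" "elt j = \<one>" using elt_surj[OF one_closed] .
      show "symbol (inv g) = cnj (symbol g)"
        using herm[OF i(1) j(1)] i j g by (simp add: B_entries)
    qed
  next
    assume herm: "\<forall>g\<in>carrier G. symbol (inv g) = cnj (symbol g)"
    have "B $$ (j, i) = cnj (B $$ (i, j))" if ij_less: "i < Suc m" "j < Suc m" for i j
    proof (cases "i = 0 \<or> j = 0")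
      case True
      then show ?thesis using ij_less by (cases i; cases j) (auto simp: B_entries)
    next
      case False
      then obtain i' j' where ij: "i = Suc i'" "j = Suc j'" "i' < m" "j' < m"
        using ij_less by (cases i; cases j) auto
      have "inv (elt i' \<otimes> inv elt j') = elt j' \<otimes> inv elt i'"
        using ij elt_closed by (simp add: inv_mult_group)
      moreover have "symbol (inv (elt i' \<otimes> inv elt j')) = cnj (symbol (elt i' \<otimes> inv elt j'))"
        using ij elt_closed herm by blast
      ultimately show ?thesis using ij by (simp add: B_entries)
    qed
    then show "mat_adjoint B = B" using mat_adjoint_eq_self_iff[OF B_carrier] by blast
  qed
  then show ?thesis using symbol_hermitian_iff by simp
qed

lemma group_cancel:
  assumes "a \<in> carrier G" "b \<in> carrier G" "c \<in> carrier G"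
  shows "a \<otimes> b \<otimes> inv b = a" "a \<otimes> inv b \<otimes> b = a" "b \<otimes> (inv b \<otimes> a) = a"
    "inv b \<otimes> (b \<otimes> a) = a" "a \<otimes> inv b \<otimes> (b \<otimes> c) = a \<otimes> c"
proof -
  show 1: "a \<otimes> b \<otimes> inv b = a" "a \<otimes> inv b \<otimes> b = a" using assms by (simp_all add: m_assoc)
  show 2: "b \<otimes> (inv b \<otimes> a) = a" "inv b \<otimes> (b \<otimes> a) = a" using assms by (simp_all flip: m_assoc)
  show "a \<otimes> inv b \<otimes> (b \<otimes> c) = a \<otimes> c"
    using assms 1(2) m_assoc[of "a \<otimes> inv b" b c] by simp
qed

lemma prod_count_sum:
  assumes "A \<subseteq> carrier G" "C \<subseteq> carrier G" and x: "x \<in> carrier G"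
  shows "of_nat (prod_count G A C x)
    = (\<Sum>g\<in>carrier G. of_bool (g \<in> A) * of_bool (inv g \<otimes> x \<in> C) :: complex)"
proof -
  have "{(g, h). g \<in> A \<and> h \<in> C \<and> g \<otimes> h = x} = (\<lambda>g. (g, inv g \<otimes> x)) ` {g \<in> A. inv g \<otimes> x \<in> C}"
  proof -
    have "h = inv g \<otimes> x" if "g \<in> A" "h \<in> C" "g \<otimes> h = x" for g h
      using that assms by (metis inv_solve_left' subsetD)
    moreover have "g \<otimes> (inv g \<otimes> x) = x" if "g \<in> A" for g
      using that assms by (metis inv_closed inv_solve_left m_closed subsetD)
    ultimately show ?thesis by auto
  qed
  then have "prod_count G A C x = card {g \<in> A. inv g \<otimes> x \<in> C}"
    unfolding prod_count_def by (simp add: card_image inj_on_def)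
  also have "{g \<in> A. inv g \<otimes> x \<in> C} = carrier G \<inter> {g. g \<in> A \<and> inv g \<otimes> x \<in> C}"
    using assms by auto
  finally show ?thesis
    using finite_carrier by (simp flip: of_bool_conj)
qed

text \<open>
  Each count is the convolution of two indicator functions, and the weights in \<open>F\<close> are the
  products of the values of the symbol, reduced by \<open>\<omega>\<^sup>3 = 1\<close> and \<open>\<omega>\<^sup>4 = \<omega>\<close>.
\<close>
lemma F_convolution:
  assumes "x \<in> carrier G"
  shows "F x = (\<Sum>g\<in>carrier G. symbol g * symbol (inv g \<otimes> x))"
proof -
  let ?w = cube_omega
  have "?w ^ 2 * ?w ^ 2 = ?w * (?w * ?w ^ 2)" by (simp add: power2_eq_square)
  then have w4: "?w ^ 2 * ?w ^ 2 = ?w" by (simp add: cube_omega_cube)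
  have product: "(s + ?w * t + ?w\<^sup>2 * v) * (s' + ?w * t' + ?w\<^sup>2 * v')
      = s * s' + ?w\<^sup>2 * (t * t') + ?w * (v * v') + ?w * (s * t' + t * s')
        + ?w\<^sup>2 * (s * v' + v * s') + t * v' + v * t'" for s t v s' t' v'
  proof -
    have "(s + ?w * t + ?w\<^sup>2 * v) * (s' + ?w * t' + ?w\<^sup>2 * v')
      = s * s' + ?w\<^sup>2 * (t * t') + (?w\<^sup>2 * ?w\<^sup>2) * (v * v') + ?w * (s * t' + t * s')
        + ?w\<^sup>2 * (s * v' + v * s') + (?w * ?w\<^sup>2) * (t * v') + (?w * ?w\<^sup>2) * (v * t')"
      by (simp add: algebra_simps power2_eq_square)
    then show ?thesis by (simp only: w4 cube_omega_cube mult_1_left)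
  qed
  show ?thesis
    unfolding cube_root_count_def symbol_def product sum.distrib sum_distrib_left[symmetric]
    by (simp only: prod_count_sum[OF _ _ assms] subsets)
qed

lemma symbol_sum:
  "(\<Sum>g\<in>carrier G. symbol g) = of_nat (card S) + cube_omega * of_nat (card T) + cube_omega\<^sup>2 * of_nat (card V)"
proof -
  have "(\<Sum>g\<in>carrier G. of_bool (g \<in> A)) = (of_nat (card A) :: complex)" if "A \<subseteq> carrier G" for A
    using that finite_carrier by (simp add: Int_absorb1)
  then show ?thesis
    using subsets by (simp add: symbol_def sum.distrib flip: sum_distrib_left)
qed

lemma symbol_sum_hermitian:
  assumes "set_inv T = V"
  shows "(\<Sum>g\<in>carrier G. symbol g) = of_real (real (card S) - real (card T))"
proof -
  have "V = (\<lambda>g. inv g) ` T" using assms by (auto simp: SET_INV_def)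
  moreover have "inj_on (\<lambda>g. inv g) T"
    using subsets(2) by (intro inj_onI) (metis inv_inv subsetD)
  ultimately have "card V = card T" by (simp add: card_image)
  then have "(\<Sum>g\<in>carrier G. symbol g)
      = of_nat (card S) + (cube_omega + cube_omega\<^sup>2) * of_nat (card T)"
    unfolding symbol_sum by (simp add: algebra_simps)
  then show ?thesis by (simp add: cube_omega_sum)
qed

text \<open>
  Multiplying the bordered matrix with itself gives \<open>m\<close> in the corner, the sum of the symbol along the
  rest of the border, and \<open>1\<close> plus the convolution square inside.  In the Hermitian case the convolution
  square at the identity is the sum of \<open>|symbol g|\<^sup>2\<close>, that is \<open>m - 1\<close>; so corner and diagonal
  always agree with the quadratic equation, and the border and the remaining entries are the
  stated conditions.
\<close>
lemma B_square_iff: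
  assumes herm: "mat_adjoint B = B"
  shows "(\<forall>i<Suc m. \<forall>j<Suc m. (\<Sum>l<Suc m. B $$ (i, l) * B $$ (l, j))
        = of_real (real (Suc m) - 1) * of_bool (i = j) + \<nu> * B $$ (i, j))
    \<longleftrightarrow> \<nu> = (\<Sum>g\<in>carrier G. symbol g) \<and> (\<forall>x\<in>carrier G - {\<one>}. F x = \<nu> * symbol x - 1)"
    (is "?square \<longleftrightarrow> ?conv")
proof -
  have conj: "symbol (inv g) = cnj (symbol g)" if "g \<in> carrier G" for g
    using herm B_hermitian_iff symbol_hermitian_iff that by blast
  have sum_suc: "(\<Sum>l<Suc m. h l) = h 0 + (\<Sum>l<m. h (Suc l))" for h :: "nat \<Rightarrow> complex"
    by (rule sum.lessThan_Suc_shift)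
  have e00: "(\<Sum>l<Suc m. B $$ (0, l) * B $$ (l, 0)) = of_nat m"
    unfolding sum_suc by (simp add: B_entries)
  have e0j: "(\<Sum>l<Suc m. B $$ (0, l) * B $$ (l, Suc j)) = (\<Sum>g\<in>carrier G. symbol g)"
    if "j < m" for j
  proof -
    have "(\<Sum>l<Suc m. B $$ (0, l) * B $$ (l, Suc j)) = (\<Sum>l<m. symbol (elt l \<otimes> inv elt j))"
      unfolding sum_suc using that by (simp add: B_entries)
    also have "\<dots> = (\<Sum>h\<in>carrier G. symbol (h \<otimes> inv elt j))" by (rule sum_elt)
    also have "\<dots> = (\<Sum>g\<in>carrier G. symbol g)"
      by (rule sum.reindex_bij_witness[of _ "\<lambda>g. g \<otimes> elt j" "\<lambda>h. h \<otimes> inv elt j"])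
        (use that elt_closed in \<open>auto simp: group_cancel\<close>)
    finally show ?thesis .
  qed
  have ei0: "(\<Sum>l<Suc m. B $$ (Suc i, l) * B $$ (l, 0)) = (\<Sum>g\<in>carrier G. symbol g)"
    if "i < m" for i
  proof -
    have "(\<Sum>l<Suc m. B $$ (Suc i, l) * B $$ (l, 0)) = (\<Sum>l<m. symbol (elt i \<otimes> inv elt l))"
      unfolding sum_suc using that by (simp add: B_entries)
    also have "\<dots> = (\<Sum>h\<in>carrier G. symbol (elt i \<otimes> inv h))" by (rule sum_elt)
    also have "\<dots> = (\<Sum>g\<in>carrier G. symbol g)"
      by (rule sum.reindex_bij_witness[of _ "\<lambda>g. inv g \<otimes> elt i" "\<lambda>h. elt i \<otimes> inv h"])
        (use that elt_closed in \<open>auto simp: inv_mult_group group_cancel\<close>)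
    finally show ?thesis .
  qed
  have eij: "(\<Sum>l<Suc m. B $$ (Suc i, l) * B $$ (l, Suc j)) = 1 + F (elt i \<otimes> inv elt j)"
    if "i < m" "j < m" for i j
  proof -
    have "(\<Sum>l<Suc m. B $$ (Suc i, l) * B $$ (l, Suc j))
        = 1 + (\<Sum>l<m. symbol (elt i \<otimes> inv elt l) * symbol (elt l \<otimes> inv elt j))"
      unfolding sum_suc using that by (simp add: B_entries)
    also have "(\<Sum>l<m. symbol (elt i \<otimes> inv elt l) * symbol (elt l \<otimes> inv elt j))
        = (\<Sum>h\<in>carrier G. symbol (elt i \<otimes> inv h) * symbol (h \<otimes> inv elt j))" by (rule sum_elt)
    also have "\<dots> = (\<Sum>g\<in>carrier G. symbol g * symbol (inv g \<otimes> (elt i \<otimes> inv elt j)))"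
      by (rule sum.reindex_bij_witness[of _ "\<lambda>g. inv g \<otimes> elt i" "\<lambda>h. elt i \<otimes> inv h"])
        (use that elt_closed in \<open>auto simp: inv_mult_group group_cancel\<close>)
    finally show ?thesis using that elt_closed by (simp add: F_convolution)
  qed
  have F_one: "1 + F \<one> = of_nat m"
  proof -
    have "F \<one> = (\<Sum>g\<in>carrier G. if g = \<one> then 0 else 1)"
      unfolding F_convolution[OF one_closed]
    proof (intro sum.cong refl)
      fix g assume g: "g \<in> carrier G"
      have "symbol g * symbol (inv g \<otimes> \<one>) = of_real ((cmod (symbol g))\<^sup>2)"
        unfolding complex_norm_square using g conj by simp
      then show "symbol g * symbol (inv g \<otimes> \<one>) = (if g = \<one> then 0 else 1)"
        using g cmod_symbol symbol_one by auto
    qed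
    also have "\<dots> = of_nat (card (carrier G - {\<one>}))"
      using finite_carrier by (simp add: sum.If_cases Diff_eq Compl_eq)
    also have "1 + \<dots> = of_nat (Suc (card (carrier G - {\<one>})))" by simp
    also have "Suc (card (carrier G - {\<one>})) = m"
      using card_Suc_Diff1[OF finite_carrier one_closed] card_carrier by simp
    finally show ?thesis .
  qed
  show ?thesis
  proof
    assume sq: ?square
    \<comment> \<open>The column of the identity already exhibits every value \<open>F x\<close>, as it contains every quotient \<open>x \<otimes> inv \<one>\<close>.\<close>
    obtain e where e: "e < m" "elt e = \<one>" using elt_surj[OF one_closed] .
    have \<nu>: "\<nu> = (\<Sum>g\<in>carrier G. symbol g)"
      using sq[rule_format, of 0 "Suc e"] e0j[OF e(1)] e by (simp add: B_entries)
    moreover have "F x = \<nu> * symbol x - 1" if x: "x \<in> carrier G - {\<one>}" for x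
    proof -
      obtain i where i: "i < m" "elt i = x" using elt_surj x by blast
      then have "i \<noteq> e" using e x by auto
      then show ?thesis
        using sq[rule_format, of "Suc i" "Suc e"] eij[OF i(1) e(1)] i e x
        by (simp add: B_entries algebra_simps)
    qed
    ultimately show ?conv by blast
  next
    assume conv: ?conv
    have "(\<Sum>l<Suc m. B $$ (i, l) * B $$ (l, j))
        = of_real (real (Suc m) - 1) * of_bool (i = j) + \<nu> * B $$ (i, j)"
      if ij_less: "i < Suc m" "j < Suc m" for i j
    proof -
      consider "i = 0" "j = 0" | j' where "i = 0" "j = Suc j'" "j' < m"
        | i' where "i = Suc i'" "j = 0" "i' < m"
        | i' j' where "i = Suc i'" "j = Suc j'" "i' < m" "j' < m"
        using ij_less by (cases i; cases j) auto
      then show ?thesis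
      proof cases
        case 1
        then show ?thesis unfolding 1 e00 by (simp add: B_entries)
      next
        case 2
        then show ?thesis unfolding 2(1,2) e0j[OF 2(3)] using conv by (simp add: B_entries)
      next
        case 3
        then show ?thesis unfolding 3(1,2) ei0[OF 3(3)] using conv by (simp add: B_entries)
      next
        case 4
        show ?thesis
        proof (cases "i' = j'")
          case True
          then show ?thesis unfolding 4(1,2) eij[OF 4(3,4)] using 4 F_one elt_closed
            by (simp add: B_entries symbol_one)
        next
          case False
          then have "elt i' \<otimes> inv elt j' \<in> carrier G - {\<one>}" using quotient_nontrivial 4(3,4) by simp
          then have "F (elt i' \<otimes> inv elt j') = \<nu> * symbol (elt i' \<otimes> inv elt j') - 1"
            using conv by blast
          then show ?thesis unfolding 4(1,2) eij[OF 4(3,4)] using 4 False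
            by (simp add: B_entries)
        qed
      qed
    qed
    then show ?square by blast
  qed
qed

lemma convolution_conditions:
  "(\<forall>x\<in>carrier G - {\<one>}. F x = \<nu> * symbol x - 1) \<longleftrightarrow>
    (\<forall>g\<in>S. F g = \<nu> - 1) \<and> (\<forall>h\<in>T. F h = cube_omega * \<nu> - 1) \<and>
    (\<forall>h\<in>V. F h = cube_omega\<^sup>2 * \<nu> - 1)"
proof -
  have "carrier G - {\<one>} = S \<union> T \<union> V" using S_sub T_sub V_eq by auto
  then show ?thesis by (auto simp: symbol_simps mult.commute ball_Un)
qed

end

section \<open>Quasi-signature pairs\<close>

theorem theorem7p2:
  fixes G :: "('a, 'b) monoid_scheme" (structure)
    and elt :: "nat \<Rightarrow> 'a"
    and m n :: nat
    and S T V :: "'a set"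
    and \<mu> :: real
  assumes "group G" and "finite (carrier G)" and "card (carrier G) = m" and "n = m + 1"
    and "bij_betw elt {0..<m} (carrier G)"
    and "S \<subseteq> carrier G - {\<one>}" and "T \<subseteq> carrier G - {\<one>}" and "S \<inter> T = {}"
    and "V = (carrier G - {\<one>}) - (S \<union> T)"
    and "\<mu> = real (card S) - real (card T)"
  shows "((\<exists>k. quasi_signature_pair G elt n k S T) \<longleftrightarrow>
            (S = set_inv S \<and> set_inv T = V) \<and>
            (\<forall>g\<in>S. cube_root_count G S T V g = complex_of_real \<mu> - 1) \<and>
            (\<forall>h\<in>T. cube_root_count G S T V h = cube_omega * complex_of_real \<mu> - 1) \<and>
            (\<forall>h\<in>V. cube_root_count G S T V h = cube_omega\<^sup>2 * complex_of_real \<mu> - 1))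
       \<and> (\<forall>k. quasi_signature_pair G elt n k S T \<longrightarrow>
            \<mu> = (real n - 2 * real k) * sqrt ((real n - 1) / (real k * (real n - real k))) \<and>
            real k = real n / 2 - \<mu> * real n / (2 * sqrt (4 * (real n - 1) + \<mu>\<^sup>2)))"
proof -
  interpret group G by fact
  interpret cube_root_partition G elt m S T V
    using assms by unfold_locales
  have n: "n = Suc m" using assms by simp
  have qsp: "quasi_signature_pair G elt n k S T \<longleftrightarrow> signature_matrix (Suc m) k B" for k
    using n card_carrier V_eq by (simp add: quasi_signature_pair_def)
  have necessary: "(S = set_inv S \<and> set_inv T = V) \<and> \<mu> = eigenvalue_sum n k \<and>
      (\<forall>x\<in>carrier G - {\<one>}. F x = of_real \<mu> * symbol x - 1) \<and> 1 \<le> k \<and> k < n"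
    if "quasi_signature_pair G elt n k S T" for k
  proof -
    have sig: "signature_matrix (Suc m) k B" using that qsp by blast
    then have herm: "mat_adjoint B = B" by (simp add: signature_matrix_def)
    have "of_real (eigenvalue_sum n k) = (\<Sum>g\<in>carrier G. symbol g) \<and>
        (\<forall>x\<in>carrier G - {\<one>}. F x = of_real (eigenvalue_sum n k) * symbol x - 1)"
      using B_square_iff[OF herm] signature_matrix_square[OF sig] n by blast
    moreover have inv: "S = set_inv S \<and> set_inv T = V" using herm B_hermitian_iff by blast
    moreover have "(\<Sum>g\<in>carrier G. symbol g) = of_real \<mu>"
      using symbol_sum_hermitian inv assms by simp
    ultimately show ?thesis using sig n by (simp add: signature_matrix_def)
  qed
  have sufficient: "\<exists>k. quasi_signature_pair G elt n k S T"
    if inv: "S = set_inv S \<and> set_inv T = V"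
      and conv: "\<forall>x\<in>carrier G - {\<one>}. F x = of_real \<mu> * symbol x - 1"
  proof -
    have herm: "mat_adjoint B = B" using inv B_hermitian_iff by blast
    have "m > 0" using elt_surj[OF one_closed] by (metis gr0I not_less0)
    then have "Suc m \<ge> 2" by simp
    moreover have "of_real \<mu> = (\<Sum>g\<in>carrier G. symbol g)"
      using symbol_sum_hermitian inv assms by simp
    ultimately have "\<exists>k. signature_matrix (Suc m) k B"
      using B_square_iff[OF herm, of "of_real \<mu>"] conv
      by (intro signature_matrixI[OF _ B_carrier herm, of \<mu>]) (auto simp: B_diagonal B_unimodular)
    then show ?thesis using qsp by blast
  qed
  have conditions: "(\<exists>k. quasi_signature_pair G elt n k S T) \<longleftrightarrow>
      (S = set_inv S \<and> set_inv T = V) \<and>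
      (\<forall>x\<in>carrier G - {\<one>}. F x = of_real \<mu> * symbol x - 1)"
    using necessary sufficient by blast
  have relation: "\<mu> = (real n - 2 * real k) * sqrt ((real n - 1) / (real k * (real n - real k))) \<and>
      real k = real n / 2 - \<mu> * real n / (2 * sqrt (4 * (real n - 1) + \<mu>\<^sup>2))"
    if "quasi_signature_pair G elt n k S T" for k
  proof -
    have \<mu>: "\<mu> = eigenvalue_sum n k" and k: "1 \<le> k" "k < n" using necessary[OF that] by auto
    show ?thesis using eigenvalue_sum_inverse[OF k] unfolding \<mu>[symmetric]
      using \<mu> unfolding eigenvalue_sum_def by (intro conjI)
  qed
  show ?thesis
    unfolding conditions convolution_conditions using relation by blast
qed

end
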